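(* Fix $d\ge 1$ and let $\tilde X$ be a $d\times p$ matrix at which prediction is desired. Let $\beta^\star$ be the true coefficient vector, with configuration $S^\star = S_{\beta^\star}$. Let $\Pi^n_\psi$ be the empirical Bayes posterior distribution of $\psi = \tilde X\beta$, and let $\mathsf{N}_d(\hat\psi_{S^\star},\sigma^2V_{S^\star})$ denote the oracle posterior for $\psi$ based on knowledge of the true configuration $S^\star$ (see the context for definitions). If $\mathsf{E}_{\beta^\star}\pi^n(S^\star)\to 1$ as $n\to\infty$, then $$\mathsf{E}_{\beta^\star}\, d_{\mathrm{TV}}\bigl(\Pi^n_\psi,\ \mathsf{N}_d(\hat\psi_{S^\star},\sigma^2V_{S^\star})\bigr)\to 0,$$ where $d_{\mathrm{TV}}(P,Q) = \sup_A|P(A)-Q(A)|$ is the total variation distance between probability measures $P$ and $Q$.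
   Context: Model: $y = X\beta + \sigma z$, with $y \in \mathbb{R}^n$, $X$ a (non-random) $n \times p$ matrix, $z$ a vector of $n$ independent standard normals, and $\sigma^2 > 0$ known. Asymptotics are as $n\to\infty$, with $p = p_n \ge n$, $X = X_n$, $\tilde X=\tilde X_n$ and $\beta^\star=\beta^\star_n$ depending on $n$; the rank $R$ of $X$ equals $n$. Standing assumption: with $s^\star=|S_{\beta^\star}|$, $s^\star\log(p/s^\star)=o(n)$. $\mathsf{E}_{\beta^\star}$ is expectation over $y \sim \mathsf{N}_n(X\beta^\star, \sigma^2 I)$. For $\beta\in\mathbb{R}^p$, $S_\beta = \{j : \beta_j \neq 0\}$, and $|S|$ is the cardinality of $S$. Empirical prior: for $S \subseteq \{1,\dots,p\}$ with $|S| \le R$, $\pi(S) = \binom{p}{|S|}^{-1} q_n(|S|)$, where $q_n$ is the probability mass function on $\{0,1,\dots,R\}$ with $q_n(s) \propto (c p^a)^{-s}$, and $a, c > 0$ are fixed constants. Let $X_S$, $\tilde X_S$ be the submatrices of $X$, $\tilde X$ with columns indexed by $S$ ($X_S^\top X_S$ is taken to be invertible for the $S$ supported by the prior) and $\hat\beta_S = (X_S^\top X_S)^{-1} X_S^\top y$ the least squares estimator. Fix constants $\gamma > 0$ and $\alpha \in (0,1)$. The prior is $$\Pi_n(d\beta) = \sum_S \pi(S)\, \mathsf{N}_{|S|}\bigl(d\beta_S \mid \hat\beta_S, \sigma^2\gamma^{-1}(X_S^\top X_S)^{-1}\bigr) \otimes \delta_{0_{S^c}}(d\beta_{S^c}),$$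 where $\delta_{0_{S^c}}$ is the point mass at the origin for the coordinates in $S^c$. Empirical Bayes posterior: $\Pi^n(d\beta) \propto L_n(\beta)^\alpha\, \Pi_n(d\beta)$, with $L_n(\beta) = \mathsf{N}_n(y \mid X\beta, \sigma^2 I) \propto \exp\{-\|y - X\beta\|^2/(2\sigma^2)\}$. The marginal posterior of $S$ is $$\pi^n(S) \propto \pi(S)\bigl(\tfrac{\gamma}{\alpha+\gamma}\bigr)^{|S|/2}\exp\{-\tfrac{\alpha}{2\sigma^2}\|y - X_S\hat\beta_S\|^2\},$$ and, given $S$, $\beta_S$ has posterior $\mathsf{N}_{|S|}(\hat\beta_S,\tfrac{\sigma^2}{\alpha+\gamma}(X_S^\top X_S)^{-1})$ and $\beta_{S^c}=0$. The induced posterior for $\psi=\tilde X\beta$ is $$\Pi^n_\psi(A) = \sum_S\pi^n(S)\,\mathsf{N}_d(A\mid\hat\psi_S,\sigma^2V_S),\quad A\subseteq\mathbb{R}^d \text{ Borel},$$ where $\hat\psi_S=\tilde X_S\hat\beta_S$ and $V_S=(\alpha+\gamma)^{-1}\tilde X_S(X_S^\top X_S)^{-1}\tilde X_S^\top$. Normal distributions with singular covariance are understood as degenerate normal laws. *)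

theory Defs
  imports
    "HOL-Probability.Probability"
    "HOL-Library.Landau_Symbols"
    "Jordan_Normal_Form.Gauss_Jordan_Elimination"
    "Jordan_Normal_Form.DL_Rank"
    "Jordan_Normal_Form.DL_Submatrix"
begin

no_notation vec_nth (infixl "$" 90)

section \<open>Normal laws on Euclidean space of variable dimension\<close>

text \<open>
  The space \<open>\<real>\<^sup>d\<close> with its Borel sets is the product measurable space of \<open>d\<close> copies of
  \<^const>\<open>borel\<close>; its points are extensional functions on \<open>{..<d}\<close>, and \<^term>\<open>vec d x\<close> is the
  vector corresponding to the point \<open>x\<close>.
\<close>

abbreviation euclid :: "nat \<Rightarrow> (nat \<Rightarrow> real) measure" where
  "euclid d \<equiv> PiM {..<d} (\<lambda>_. borel)"

definition std_gauss :: "nat \<Rightarrow> (nat \<Rightarrow> real) measure" where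
  "std_gauss d = PiM {..<d} (\<lambda>_. density lborel (\<lambda>x. ennreal (std_normal_density x)))"

definition cov_root :: "real mat \<Rightarrow> real mat" where
  "cov_root \<Sigma> = (SOME A. A \<in> carrier_mat (dim_row \<Sigma>) (dim_row \<Sigma>) \<and> A * A\<^sup>T = \<Sigma>)"

text \<open>
  The law of \<open>m + A z\<close> with \<open>z\<close> standard normal and \<open>A A\<^sup>T = \<Sigma>\<close>. Such an \<open>A\<close> exists for every
  symmetric positive semidefinite \<open>\<Sigma>\<close> and the law does not depend on its choice. If \<open>\<Sigma>\<close> is
  singular this is the degenerate normal law, supported on \<open>m\<close> plus the column space of \<open>\<Sigma>\<close>.
\<close>

definition multi_normal :: "real vec \<Rightarrow> real mat \<Rightarrow> (nat \<Rightarrow> real) measure" where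
  "multi_normal m \<Sigma> =
     distr (std_gauss (dim_vec m)) (euclid (dim_vec m))
       (\<lambda>z. \<lambda>i\<in>{..<dim_vec m}. m $ i + (\<Sum>j<dim_vec m. cov_root \<Sigma> $$ (i, j) * z j))"

definition tv_dist :: "'a measure \<Rightarrow> 'a measure \<Rightarrow> real" where
  "tv_dist P Q = (SUP A\<in>sets P. \<bar>measure P A - measure Q A\<bar>)"

section \<open>Least squares\<close>

text \<open>Rows, columns and coordinates are indexed from 0.\<close>

definition supp :: "real vec \<Rightarrow> nat set" where
  "supp \<beta> = {j. j < dim_vec \<beta> \<and> \<beta> $ j \<noteq> 0}"

definition sub_cols :: "real mat \<Rightarrow> nat set \<Rightarrow> real mat" where
  "sub_cols X S = submatrix X UNIV S"

definition gram :: "real mat \<Rightarrow> nat set \<Rightarrow> real mat" where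
  "gram X S = (sub_cols X S)\<^sup>T * sub_cols X S"

definition gram_inv :: "real mat \<Rightarrow> nat set \<Rightarrow> real mat" where
  "gram_inv X S = the (mat_inverse (gram X S))"

definition lse :: "real mat \<Rightarrow> real vec \<Rightarrow> nat set \<Rightarrow> real vec" where
  "lse X y S = gram_inv X S *\<^sub>v ((sub_cols X S)\<^sup>T *\<^sub>v y)"

definition rss :: "real mat \<Rightarrow> real vec \<Rightarrow> nat set \<Rightarrow> real" where
  "rss X y S = (let r = y - sub_cols X S *\<^sub>v lse X y S in r \<bullet> r)"

definition mat_rank :: "real mat \<Rightarrow> nat" where
  "mat_rank X = vec_space.rank (dim_row X) X"

section \<open>Empirical prior and posterior\<close>

definition size_prior :: "real \<Rightarrow> real \<Rightarrow> nat \<Rightarrow> nat \<Rightarrow> nat \<Rightarrow> real" where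
  "size_prior a c R p s =
     (if s \<le> R
      then (c * real p powr a) powi (- int s) / (\<Sum>t\<le>R. (c * real p powr a) powi (- int t))
      else 0)"

definition config_prior :: "real \<Rightarrow> real \<Rightarrow> real mat \<Rightarrow> nat set \<Rightarrow> real" where
  "config_prior a c X S =
     size_prior a c (mat_rank X) (dim_col X) (card S) / real (dim_col X choose card S)"

definition configs :: "real mat \<Rightarrow> nat set set" where
  "configs X = {S. S \<subseteq> {..<dim_col X} \<and> card S \<le> mat_rank X}"

text \<open>
  The unnormalized marginal posterior mass of \<open>S\<close>: the integral of the \<open>\<alpha>\<close>-th power of the
  likelihood against the normal conditional prior of \<open>\<beta>\<^sub>S\<close>, which is centred at the least
  squares estimator, times the prior mass of \<open>S\<close>. The factor \<open>(2 \<pi> \<sigma>\<^sup>2) powr (- \<alpha> n / 2)\<close>,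
  common to all \<open>S\<close>, is dropped.
\<close>

definition config_weight ::
    "real \<Rightarrow> real \<Rightarrow> real \<Rightarrow> real \<Rightarrow> real \<Rightarrow> real mat \<Rightarrow> real vec \<Rightarrow> nat set \<Rightarrow> real" where
  "config_weight a c \<gamma> \<alpha> \<sigma> X y S =
     config_prior a c X S * (\<gamma> / (\<alpha> + \<gamma>)) powr (real (card S) / 2)
       * exp (- (\<alpha> / (2 * \<sigma>\<^sup>2)) * rss X y S)"

definition config_post ::
    "real \<Rightarrow> real \<Rightarrow> real \<Rightarrow> real \<Rightarrow> real \<Rightarrow> real mat \<Rightarrow> real vec \<Rightarrow> nat set \<Rightarrow> real" where
  "config_post a c \<gamma> \<alpha> \<sigma> X y S =
     config_weight a c \<gamma> \<alpha> \<sigma> X y S / (\<Sum>T\<in>configs X. config_weight a c \<gamma> \<alpha> \<sigma> X y T)"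

definition pred_mean :: "real mat \<Rightarrow> real mat \<Rightarrow> real vec \<Rightarrow> nat set \<Rightarrow> real vec" where
  "pred_mean X X' y S = sub_cols X' S *\<^sub>v lse X y S"

definition pred_cov :: "real \<Rightarrow> real \<Rightarrow> real mat \<Rightarrow> real mat \<Rightarrow> nat set \<Rightarrow> real mat" where
  "pred_cov \<gamma> \<alpha> X X' S =
     (1 / (\<alpha> + \<gamma>)) \<cdot>\<^sub>m (sub_cols X' S * gram_inv X S * (sub_cols X' S)\<^sup>T)"

text \<open>
  The conditional posterior of \<open>X' \<beta>\<close> given the configuration \<open>S\<close>; for \<open>S\<close> the support of the
  true coefficient vector this is the oracle posterior.
\<close>

definition pred_normal ::
    "real \<Rightarrow> real \<Rightarrow> real \<Rightarrow> real mat \<Rightarrow> real mat \<Rightarrow> real vec \<Rightarrow> nat set \<Rightarrow> (nat \<Rightarrow> real) measure" where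
  "pred_normal \<gamma> \<alpha> \<sigma> X X' y S =
     multi_normal (pred_mean X X' y S) (\<sigma>\<^sup>2 \<cdot>\<^sub>m pred_cov \<gamma> \<alpha> X X' S)"

definition pred_post ::
    "real \<Rightarrow> real \<Rightarrow> real \<Rightarrow> real \<Rightarrow> real \<Rightarrow> real mat \<Rightarrow> real mat \<Rightarrow> real vec \<Rightarrow> (nat \<Rightarrow> real) measure" where
  "pred_post a c \<gamma> \<alpha> \<sigma> X X' y =
     measure_of (space (euclid (dim_row X'))) (sets (euclid (dim_row X')))
       (\<lambda>A. \<Sum>S\<in>configs X. ennreal (config_post a c \<gamma> \<alpha> \<sigma> X y S)
                             * emeasure (pred_normal \<gamma> \<alpha> \<sigma> X X' y S) A)"

text \<open>The law of \<open>y = X \<beta> + \<sigma> z\<close>.\<close>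

definition data_law :: "real \<Rightarrow> real mat \<Rightarrow> real vec \<Rightarrow> (nat \<Rightarrow> real) measure" where
  "data_law \<sigma> X \<beta> = multi_normal (X *\<^sub>v \<beta>) (\<sigma>\<^sup>2 \<cdot>\<^sub>m 1\<^sub>m (dim_row X))"

end

theory Submission
  imports Defs
begin

text \<open>
  The posterior of \<open>\<psi>\<close> is a mixture of the conditional posteriors given \<open>S\<close>, so its distance
  to the component at the true configuration \<open>S\<^sup>\<star>\<close> is at most the mass \<open>1 - \<pi>\<^sup>n(S\<^sup>\<star>)\<close> of the
  other components, and the expectation of that mass tends to 0 by hypothesis.

  No measurability in \<open>y\<close> has to be established. The integral of a non-integrable function is 0,
  so the expectation of \<open>\<pi>\<^sup>n(S\<^sup>\<star>)\<close> being close to 1 already makes it integrable, and a total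
  variation distance that failed to be integrable would have integral 0.
\<close>

text \<open>Since the weights sum to 1, \<open>P - N k\<close> is the sum over \<open>i\<close> of
  \<open>w i\<close> times \<open>N i - N k\<close>. The term \<open>i = k\<close> vanishes, and on
  any event two probabilities differ by at most 1, so only the weight outside \<open>k\<close>
  remains.\<close>

lemma
  fixes w :: "'i \<Rightarrow> real" and N :: "'i \<Rightarrow> 'a measure"
  assumes fin: "finite I" and w0: "\<And>i. i \<in> I \<Longrightarrow> 0 \<le> w i" and w1: "(\<Sum>i\<in>I. w i) = 1"
    and pN: "\<And>i. i \<in> I \<Longrightarrow> prob_space (N i)"
    and sN: "\<And>i. i \<in> I \<Longrightarrow> sets (N i) = sets M"
    and k: "k \<in> I"
  defines "P \<equiv> measure_of (space M) (sets M) (\<lambda>A. \<Sum>i\<in>I. ennreal (w i) * emeasure (N i) A)"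
  shows tv_dist_mixture_component_le: "tv_dist P (N k) \<le> 1 - w k"
    and tv_dist_mixture_component_nonneg: "0 \<le> tv_dist P (N k)"
proof -
  let ?\<mu> = "\<lambda>A. \<Sum>i\<in>I. ennreal (w i) * emeasure (N i) A"
  have setsP: "sets P = sets M"
    by (simp add: P_def)
  \<comment> \<open>\<open>measure_of\<close> yields the zero measure when its set function is not a
    measure, so countable additivity is what gives \<open>P\<close> the intended values.\<close>
  have ca: "countably_additive (sets M) ?\<mu>"
  proof (rule countably_additiveI)
    fix A :: "nat \<Rightarrow> 'a set"
    assume A: "range A \<subseteq> sets M" "disjoint_family A" "(\<Union>i. A i) \<in> sets M"
    have "(\<Sum>n. ?\<mu> (A n)) = (\<Sum>i\<in>I. \<Sum>n. ennreal (w i) * emeasure (N i) (A n))"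
      by (rule suminf_sum) simp
    also have "\<dots> = ?\<mu> (\<Union>i. A i)"
      using A by (intro sum.cong refl) (simp add: ennreal_suminf_cmult suminf_emeasure sN)
    finally show "(\<Sum>n. ?\<mu> (A n)) = ?\<mu> (\<Union>i. A i)" .
  qed
  have measP: "measure P A = (\<Sum>i\<in>I. w i * measure (N i) A)" if A: "A \<in> sets M" for A
  proof -
    have "emeasure P A = ?\<mu> A"
      by (rule emeasure_measure_of[OF P_def[THEN meta_eq_to_obj_eq]])
         (use A ca sets.space_closed in \<open>auto simp: positive_def setsP\<close>)
    also have "\<dots> = (\<Sum>i\<in>I. ennreal (w i * measure (N i) A))"
      by (intro sum.cong refl)
         (simp add: w0 pN ennreal_mult prob_space.finite_measure finite_measure.emeasure_eq_measure)
    also have "\<dots> = ennreal (\<Sum>i\<in>I. w i * measure (N i) A)"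
      by (intro sum_ennreal) (simp add: w0)
    finally show ?thesis
      by (simp add: measure_def sum_nonneg w0)
  qed
  have bound: "\<bar>measure P A - measure (N k) A\<bar> \<le> 1 - w k" if A: "A \<in> sets P" for A
  proof -
    have N01: "0 \<le> measure (N i) A" "measure (N i) A \<le> 1" if "i \<in> I" for i
      using pN[OF that] by (simp_all add: prob_space.prob_le_1)
    \<comment> \<open>Here \<open>measure (N k) A\<close> is spread over all components by
      multiplying it with the total weight 1.\<close>
    have "measure P A - measure (N k) A = (\<Sum>i\<in>I. w i * (measure (N i) A - measure (N k) A))"
      using A w1 by (simp add: measP setsP right_diff_distrib sum_subtractf flip: sum_distrib_right)
    also have "\<dots> = (\<Sum>i\<in>I - {k}. w i * (measure (N i) A - measure (N k) A))"
      using fin k by (simp add: sum.remove)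
    also have "\<bar>\<dots>\<bar> \<le> (\<Sum>i\<in>I - {k}. w i)"
    proof (rule order_trans[OF sum_abs], rule sum_mono)
      fix i assume "i \<in> I - {k}"
      then have i: "i \<in> I"
        by simp
      have "\<bar>measure (N i) A - measure (N k) A\<bar> \<le> 1"
        using N01[OF k] N01[OF i] by linarith
      then show "\<bar>w i * (measure (N i) A - measure (N k) A)\<bar> \<le> w i"
        using w0[OF i] by (simp add: abs_mult mult_left_le)
    qed
    also have "\<dots> = 1 - w k"
      using fin k w1 by (simp add: sum_diff1)
    finally show ?thesis .
  qed
  have ne: "sets P \<noteq> {}"
    using sets.empty_sets by blast
  show "tv_dist P (N k) \<le> 1 - w k"
    unfolding tv_dist_def by (rule cSUP_least[OF ne bound])
  \<comment> \<open>A real supremum dominates its members only if the family is bounded above, which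
    \<open>bound\<close> supplies. The empty set is a member with value 0.\<close>
  have "\<bar>measure P {} - measure (N k) {}\<bar> \<le> tv_dist P (N k)"
    unfolding tv_dist_def
    by (rule cSUP_upper) (auto intro!: bdd_aboveI2[OF bound])
  then show "0 \<le> tv_dist P (N k)"
    by simp
qed

lemma prob_space_std_gauss: "prob_space (std_gauss d)"
  unfolding std_gauss_def
  by (intro prob_space_PiM prob_space_normal_density) simp

text \<open>The law is the image of a standard normal law under an affine map. Such a map is
  measurable whatever matrix \<open>cov_root\<close> selects, so no factorization of
  \<open>\<Sigma>\<close> has to be exhibited.\<close>

lemma prob_space_multi_normal: "prob_space (multi_normal m \<Sigma>)"
  unfolding multi_normal_def
proof (rule prob_space.prob_space_distr[OF prob_space_std_gauss])
  have s: "sets (std_gauss (dim_vec m)) = sets (euclid (dim_vec m))"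
    unfolding std_gauss_def by (intro sets_PiM_cong) simp_all
  show "(\<lambda>z. \<lambda>i\<in>{..<dim_vec m}. m $ i + (\<Sum>j<dim_vec m. cov_root \<Sigma> $$ (i, j) * z j))
          \<in> measurable (std_gauss (dim_vec m)) (euclid (dim_vec m))"
    unfolding measurable_cong_sets[OF s refl] by measurable
qed

lemma prob_space_pred_normal: "prob_space (pred_normal \<gamma> \<alpha> \<sigma> X X' y S)"
  unfolding pred_normal_def by (rule prob_space_multi_normal)

lemma sets_pred_normal: "sets (pred_normal \<gamma> \<alpha> \<sigma> X X' y S) = sets (euclid (dim_row X'))"
  by (simp add: pred_normal_def multi_normal_def pred_mean_def sub_cols_def dim_submatrix)

lemma finite_configs: "finite (configs X)"
  by (rule finite_subset[of _ "Pow {..<dim_col X}"]) (auto simp: configs_def)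

lemma supp_in_configs_iff:
  "dim_vec \<beta> = dim_col X \<Longrightarrow> supp \<beta> \<in> configs X \<longleftrightarrow> card (supp \<beta>) \<le> mat_rank X"
  by (auto simp: configs_def supp_def)

lemma size_prior_nonneg: "0 \<le> c \<Longrightarrow> 0 \<le> size_prior a c R p s"
  by (simp add: size_prior_def sum_nonneg)

lemma config_weight_nonneg: "0 \<le> c \<Longrightarrow> 0 \<le> config_weight a c \<gamma> \<alpha> \<sigma> X y S"
  by (simp add: config_weight_def config_prior_def size_prior_nonneg)

text \<open>Strict positivity makes the normalizing sum of \<open>config_post\<close> nonzero, so
  that the posterior masses really add up to 1. A positive number of columns keeps the base
  \<open>c * real p powr a\<close> of the size prior away from 0.\<close>

lemma config_weight_pos:
  assumes "0 < c" "0 < \<gamma>" "0 < \<alpha>" "0 < dim_col X" "S \<in> configs X"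
  shows "0 < config_weight a c \<gamma> \<alpha> \<sigma> X y S"
proof -
  \<comment> \<open>This makes the binomial coefficient in the denominator of
    \<open>config_prior\<close> positive.\<close>
  have "card S \<le> dim_col X"
    using card_mono[of "{..<dim_col X}" S] assms(5) by (auto simp: configs_def)
  moreover have "0 < (\<Sum>t\<le>mat_rank X. (c * real (dim_col X) powr a) powi (- int t))"
    using assms by (intro sum_pos) auto
  ultimately show ?thesis
    using assms by (simp add: config_weight_def config_prior_def size_prior_def configs_def)
qed

lemma config_post_nonneg: "0 \<le> c \<Longrightarrow> 0 \<le> config_post a c \<gamma> \<alpha> \<sigma> X y S"
  by (simp add: config_post_def config_weight_nonneg sum_nonneg)

text \<open>The size prior vanishes beyond the rank. Read contrapositively, a positive expected
  posterior mass forces the true configuration to be one of the mixture components.\<close>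

lemma config_post_eq_0: "mat_rank X < card S \<Longrightarrow> config_post a c \<gamma> \<alpha> \<sigma> X y S = 0"
  by (simp add: config_post_def config_weight_def config_prior_def size_prior_def)

lemma sum_config_post:
  assumes "0 < c" "0 < \<gamma>" "0 < \<alpha>" "0 < dim_col X" "configs X \<noteq> {}"
  shows "(\<Sum>S\<in>configs X. config_post a c \<gamma> \<alpha> \<sigma> X y S) = 1"
proof -
  have "0 < (\<Sum>S\<in>configs X. config_weight a c \<gamma> \<alpha> \<sigma> X y S)"
    using assms by (intro sum_pos finite_configs config_weight_pos)
  then show ?thesis
    by (simp add: config_post_def flip: sum_divide_distrib)
qed

lemma
  assumes "0 < c" "0 < \<gamma>" "0 < \<alpha>" "0 < dim_col X" and S: "S \<in> configs X"
  shows tv_dist_pred_post_le: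
      "tv_dist (pred_post a c \<gamma> \<alpha> \<sigma> X X' y) (pred_normal \<gamma> \<alpha> \<sigma> X X' y S)
         \<le> 1 - config_post a c \<gamma> \<alpha> \<sigma> X y S"
    and tv_dist_pred_post_nonneg:
      "0 \<le> tv_dist (pred_post a c \<gamma> \<alpha> \<sigma> X X' y) (pred_normal \<gamma> \<alpha> \<sigma> X X' y S)"
proof -
  have ne: "configs X \<noteq> {}"
    using S by auto
  note mix = finite_configs config_post_nonneg[OF less_imp_le[OF assms(1)]]
    sum_config_post[OF assms(1-4) ne] prob_space_pred_normal sets_pred_normal S
  show "tv_dist (pred_post a c \<gamma> \<alpha> \<sigma> X X' y) (pred_normal \<gamma> \<alpha> \<sigma> X X' y S)
         \<le> 1 - config_post a c \<gamma> \<alpha> \<sigma> X y S"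
    unfolding pred_post_def by (rule tv_dist_mixture_component_le[OF mix])
  show "0 \<le> tv_dist (pred_post a c \<gamma> \<alpha> \<sigma> X X' y) (pred_normal \<gamma> \<alpha> \<sigma> X X' y S)"
    unfolding pred_post_def by (rule tv_dist_mixture_component_nonneg[OF mix])
qed

text \<open>If \<open>f\<close> is not integrable, its integral is 0 and the bound survives because
  \<open>1 - g\<close> dominates \<open>f\<close> and is thus nonnegative. Otherwise this is
  monotonicity of the integral.\<close>

lemma (in prob_space) integral_le_one_minus:
  fixes f g :: "'a \<Rightarrow> real"
  assumes "integrable M g" "\<And>x. 0 \<le> f x" "\<And>x. f x \<le> 1 - g x"
  shows "(\<integral>x. f x \<partial>M) \<le> 1 - (\<integral>x. g x \<partial>M)"
proof -
  have i: "integrable M (\<lambda>x. 1 - g x)"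
    using assms(1) by simp
  have "(\<integral>x. f x \<partial>M) \<le> (\<integral>x. 1 - g x \<partial>M)"
    by (rule integral_mono'[OF i]) (use assms(2,3) order_trans[OF assms(2,3)] in blast)+
  then show ?thesis
    using assms(1) by (simp add: prob_space)
qed

theorem theorem3:
  fixes a c \<gamma> \<alpha> \<sigma> :: real
    and d :: nat
    and p :: "nat \<Rightarrow> nat"
    and X X' :: "nat \<Rightarrow> real mat"
    and \<beta> :: "nat \<Rightarrow> real vec"
  assumes "a > 0" and "c > 0" and "\<gamma> > 0" and "0 < \<alpha>" and "\<alpha> < 1" and "\<sigma> > 0"
    and "d \<ge> 1"
    and "\<And>n. p n \<ge> n"
    and "\<And>n. X n \<in> carrier_mat n (p n)"
    and "\<And>n. mat_rank (X n) = n"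
    and "\<And>n S. S \<in> configs (X n) \<Longrightarrow> invertible_mat (gram (X n) S)"
    and "\<And>n. X' n \<in> carrier_mat d (p n)"
    and "\<And>n. \<beta> n \<in> carrier_vec (p n)"
    and "(\<lambda>n. real (card (supp (\<beta> n))) * ln (real (p n) / real (card (supp (\<beta> n)))))
           \<in> o(\<lambda>n. real n)"
    and "(\<lambda>n. \<integral>y. config_post a c \<gamma> \<alpha> \<sigma> (X n) (vec n y) (supp (\<beta> n))
                \<partial>data_law \<sigma> (X n) (\<beta> n)) \<longlonglongrightarrow> 1"
  shows "(\<lambda>n. \<integral>y. tv_dist (pred_post a c \<gamma> \<alpha> \<sigma> (X n) (X' n) (vec n y))
                       (pred_normal \<gamma> \<alpha> \<sigma> (X n) (X' n) (vec n y) (supp (\<beta> n)))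
                \<partial>data_law \<sigma> (X n) (\<beta> n)) \<longlonglongrightarrow> 0"
proof -
  let ?w = "\<lambda>n y. config_post a c \<gamma> \<alpha> \<sigma> (X n) (vec n y) (supp (\<beta> n))"
  let ?tv = "\<lambda>n y. tv_dist (pred_post a c \<gamma> \<alpha> \<sigma> (X n) (X' n) (vec n y))
                     (pred_normal \<gamma> \<alpha> \<sigma> (X n) (X' n) (vec n y) (supp (\<beta> n)))"
  let ?D = "\<lambda>n. data_law \<sigma> (X n) (\<beta> n)"
  have "eventually (\<lambda>n. 0 < (\<integral>y. ?w n y \<partial>?D n)) sequentially"
    using order_tendstoD(1)[OF assms(15)] by simp
  then have "eventually (\<lambda>n. 0 \<le> (\<integral>y. ?tv n y \<partial>?D n)
      \<and> (\<integral>y. ?tv n y \<partial>?D n) \<le> 1 - (\<integral>y. ?w n y \<partial>?D n)) sequentially"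
    using eventually_gt_at_top[of 0]
  proof eventually_elim
    case (elim n)
    have "integrable (?D n) (?w n)"
      using elim(1) not_integrable_integral_eq by fastforce
    \<comment> \<open>A support larger than the rank would make the integrand identically 0, against
      the positive expectation.\<close>
    have "card (supp (\<beta> n)) \<le> mat_rank (X n)"
      using elim(1) config_post_eq_0[of "X n" "supp (\<beta> n)"]
      by (cases "card (supp (\<beta> n)) \<le> mat_rank (X n)") auto
    then have S: "supp (\<beta> n) \<in> configs (X n)"
      using assms(9)[of n] assms(13)[of n] by (subst supp_in_configs_iff) auto
    \<comment> \<open>From \<open>p n \<ge> n\<close> and \<open>n > 0\<close>; this is why
      \<open>n = 0\<close> was discarded.\<close>
    have p: "0 < dim_col (X n)"
      using assms(8)[of n] assms(9)[of n] elim(2) by auto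
    have "prob_space (?D n)"
      unfolding data_law_def by (rule prob_space_multi_normal)
    then have "(\<integral>y. ?tv n y \<partial>?D n) \<le> 1 - (\<integral>y. ?w n y \<partial>?D n)"
      using \<open>integrable (?D n) (?w n)\<close> tv_dist_pred_post_nonneg[OF assms(2-4) p S]
        tv_dist_pred_post_le[OF assms(2-4) p S]
      by (rule prob_space.integral_le_one_minus)
    moreover have "0 \<le> (\<integral>y. ?tv n y \<partial>?D n)"
      by (rule Bochner_Integration.integral_nonneg) (rule tv_dist_pred_post_nonneg[OF assms(2-4) p S])
    ultimately show ?case
      by (rule conjI[rotated])
  qed
  then have "eventually (\<lambda>n. 0 \<le> (\<integral>y. ?tv n y \<partial>?D n)) sequentially"
      "eventually (\<lambda>n. (\<integral>y. ?tv n y \<partial>?D n) \<le> 1 - (\<integral>y. ?w n y \<partial>?D n)) sequentially"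
    unfolding eventually_conj_iff by (rule conjunct1, rule conjunct2)
  moreover have "(\<lambda>n. 1 - (\<integral>y. ?w n y \<partial>?D n)) \<longlonglongrightarrow> 0"
    using tendsto_diff[OF tendsto_const[of 1] assms(15)] by simp
  ultimately show ?thesis
    by (rule tendsto_sandwich[OF _ _ tendsto_const])
qed

end
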